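(* Let $\gamma$ be a Jordan curve (a simple closed curve) in the plane $\mathbb{R}^2$ that has bounded convex curvature. Then the interior $\operatorname{Int}\gamma$ contains an open disk of radius $1$.
   Context: For a Jordan curve $\gamma$, $\operatorname{Int}\gamma$ and $\operatorname{Ext}\gamma$ denote the bounded and unbounded components of $\mathbb{R}^2\setminus\gamma$. $B(x,\varepsilon)$ denotes the open disk of center $x$ and radius $\varepsilon$. A Jordan curve $\gamma$ has bounded convex curvature if for every point $x\in\gamma$ there exist an open disk $U_x$ of radius $1$ and $\varepsilon_x>0$ such that $x\in\partial U_x$ and $B(x,\varepsilon_x)\cap U_x\subset\operatorname{Int}\gamma$. No differentiability of $\gamma$ is assumed. *)

theory Defs
  imports "HOL-Analysis.Analysis"
begin

definition jordan_curve :: "(real \<Rightarrow> complex) \<Rightarrow> bool" where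
  "jordan_curve g \<longleftrightarrow> simple_path g \<and> pathfinish g = pathstart g"

definition bounded_convex_curvature :: "(real \<Rightarrow> complex) \<Rightarrow> bool" where
  "bounded_convex_curvature g \<longleftrightarrow>
     (\<forall>x \<in> path_image g. \<exists>c \<epsilon>. x \<in> frontier (ball c 1) \<and> \<epsilon> > 0 \<and>
        ball x \<epsilon> \<inter> ball c 1 \<subseteq> inside (path_image g))"

end

theory Submission
  imports Defs
begin

text \<open>Suppose there is no inscribed unit disk; by compactness the radii of inscribed disks are then
  bounded by some \<open>\<rho> < 1\<close>.  Every point of the curve is touched by an inscribed disk that touches the
  curve in a second point as well.  Two such disks with neither contact pair inside the other disk
  have non-crossing chords, so by the theta-curve theorem the disk touching at the middle of an arc
  whose ends share an inscribed disk again has its second contact on that arc (unless it is the same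
  disk).  Halving repeatedly gives an arc of diameter less than \<open>1 - \<rho>\<close> whose ends share an inscribed
  disk.  At its point farthest from the center of this disk, the curve turns more sharply than a unit
  circle, contradicting bounded convex curvature.\<close>

section \<open>Insides of curves, disks and their chords\<close>

text \<open>Otherwise the connected set would meet the frontier of the inside, and that frontier is
  contained in \<open>G\<close>.\<close>

lemma connected_subset_inside:
  fixes S G :: "'a::real_normed_vector set"
  assumes "closed G" "connected S" "S \<inter> G = {}" "S \<inter> inside G \<noteq> {}"
  shows "S \<subseteq> inside G"
  using connected_Int_frontier[OF assms(2,4)] frontier_inside_subset[OF assms(1)] assms(3)
  by blast

lemma ball_inside_imp_dist_ge:
  fixes c :: "'a::real_normed_vector"
  assumes "ball c r \<subseteq> inside G" "x \<in> G"
  shows "r \<le> dist c x"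
proof (rule ccontr)
  assume "\<not> r \<le> dist c x"
  then have "x \<in> inside G" using assms(1) by auto
  then show False using assms(2) inside_no_overlap[of G] by blast
qed

lemma open_segment_subset_ball:
  fixes x y :: "'a::euclidean_space"
  assumes "dist c x \<le> r" "dist c y \<le> r"
  shows "open_segment x y \<subseteq> ball c r"
  using assms dist_decreases_open_segment[of _ x y c] by fastforce

lemma inside_subset_cball:
  fixes S :: "'a::euclidean_space set"
  assumes "S \<subseteq> cball c R"
  shows "inside S \<subseteq> cball c R"
  using inside_mono[OF assms] inside_convex[OF convex_cball, of c R] by auto

text \<open>The difference of the powers of a point with respect to the two circles is affine; its zero
  line separates the two chords.\<close>

lemma chords_disjoint:
  fixes x y z w :: "'a::real_inner"
  assumes x: "dist c x = r" "r' \<le> dist c' x" and y: "dist c y = r" "r' \<le> dist c' y"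
    and z: "dist c' z = r'" "r < dist c z" and w: "dist c' w = r'" "r \<le> dist c w"
  shows "open_segment z w \<inter> closed_segment x y = {}"
proof -
  define h where "h q = (c - c') \<bullet> q" for q
  \<comment> \<open>\<open>2 * (k - h q)\<close> is the power of \<open>q\<close> for the circle
    about \<open>c\<close> minus its power for the circle about \<open>c'\<close>, so
    \<open>h q = k\<close> is the radical axis.\<close>
  define k where "k = (c \<bullet> c - c' \<bullet> c' - (r\<^sup>2 - r'\<^sup>2)) / 2"
  have pow: "(dist c q)\<^sup>2 - (dist c' q)\<^sup>2 = c \<bullet> c - c' \<bullet> c' - 2 * h q" for q
    by (simp add: h_def dist_norm power2_norm_eq_inner inner_diff_left inner_diff_right
        inner_commute algebra_simps)
  have rr: "0 \<le> r" "0 \<le> r'"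
    using x(1) z(1) by auto
  have hx: "h x \<ge> k" and hy: "h y \<ge> k"
    using pow[of x] pow[of y] x y power_mono[OF x(2) rr(2), of 2] power_mono[OF y(2) rr(2), of 2]
    by (auto simp: k_def)
  \<comment> \<open>Strictness at \<open>z\<close> alone suffices, since every point of the open
    segment gives \<open>z\<close> positive weight.\<close>
  have hz: "h z < k" and hw: "h w \<le> k"
    using pow[of z] pow[of w] z w power_strict_mono[OF z(2) rr(1), of 2]
      power_mono[OF w(2) rr(1), of 2]
    by (auto simp: k_def)
  have "closed_segment x y \<subseteq> {q. h q \<ge> k}"
    using hx hy convex_halfspace_ge[of k "c - c'"]
    by (intro closed_segment_subset) (auto simp: h_def)
  moreover have "h q < k" if q: "q \<in> open_segment z w" for q
  proof -
    obtain u where u: "0 < u" "u < 1" "q = (1 - u) *\<^sub>R z + u *\<^sub>R w"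
      using q by (auto simp: in_segment)
    have "h q = (1 - u) * h z + u * h w"
      by (simp add: u h_def inner_add_right)
    also have "\<dots> < (1 - u) * k + u * k"
      using u hz hw by (intro add_less_le_mono mult_strict_left_mono mult_left_mono) auto
    finally show ?thesis by (simp add: algebra_simps)
  qed
  ultimately show ?thesis by fastforce
qed

text \<open>A unit circle bends less than a circle of radius \<open>R < 1\<close>. With
  \<open>a\<close>, \<open>b\<close> the vectors from \<open>p\<close> to the two centers,
  \<open>p + d\<close> lies in the unit disk iff \<open>d \<bullet> d < 2 * (d \<bullet> a)\<close>
  and outside the other disk iff \<open>d \<bullet> d > 2 * (d \<bullet> b)\<close>; a short,
  suitably tilted \<open>d\<close> satisfies both.\<close>

lemma unit_ball_germ_not_in_smaller_cball:
  fixes p u c :: complex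
  assumes u: "dist u p = 1" and c: "dist c p = R" "R < 1" and e: "0 < e"
  shows "\<not> ball p e \<inter> ball u 1 \<subseteq> cball c R"
proof -
  define a b where "a = u - p" and "b = c - p"
  have na: "norm a = 1" and nb: "norm b = R" "0 \<le> R"
    using u c by (auto simp: a_def b_def dist_norm)
  \<comment> \<open>A unit tangent of the unit circle at \<open>p\<close>, with its sign chosen so
    that the tangential part of \<open>d\<close> cannot increase
    \<open>d \<bullet> b\<close>.\<close>
  define j where "j = (if (\<i> * a) \<bullet> b \<le> 0 then \<i> * a else - \<i> * a)"
  have j: "j \<bullet> b \<le> 0" "norm j = 1"
    by (auto simp: j_def na norm_mult)
  have ja: "j \<bullet> a = 0"
    by (auto simp: j_def inner_complex_def)
  \<comment> \<open>The bound by 1 keeps the radicand of \<open>\<tau>\<close> nonnegative; the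
    bound by \<open>e\<^sup>2\<close> gives \<open>d \<bullet> d < 2 * k \<le> e\<^sup>2\<close>,
    which keeps \<open>p + d\<close> in \<open>ball p e\<close>.\<close>
  define k where "k = min 1 (e\<^sup>2) / 2"
  have k: "0 < k" "k < 1" "2 * k \<le> e\<^sup>2"
    using e by (auto simp: k_def)
  \<comment> \<open>Makes \<open>d \<bullet> d = k * (1 + R)\<close> below, strictly between \<open>2 * k * R\<close> and \<open>2 * k\<close>.\<close>
  define \<tau> where "\<tau> = sqrt (k * (1 + R) - k\<^sup>2)"
  have "k\<^sup>2 \<le> k * (1 + R)"
    using k nb by (auto simp: power2_eq_square)
  then have \<tau>: "0 \<le> \<tau>" "\<tau>\<^sup>2 = k * (1 + R) - k\<^sup>2"
    by (auto simp: \<tau>_def)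
  define d where "d = k *\<^sub>R a + \<tau> *\<^sub>R j"
  have dd: "d \<bullet> d = k * (1 + R)"
  proof -
    have "a \<bullet> a = 1" "j \<bullet> j = 1" "a \<bullet> j = 0"
      using na j ja by (auto simp: dot_square_norm inner_commute)
    then have "d \<bullet> d = k\<^sup>2 + \<tau>\<^sup>2"
      using ja by (simp add: d_def inner_add_left inner_add_right power2_eq_square)
    then show ?thesis by (simp add: \<tau>)
  qed
  have da: "d \<bullet> a = k"
    using na ja by (simp add: d_def inner_add_left dot_square_norm)
  have "a \<bullet> b \<le> R"
    using norm_cauchy_schwarz[of a b] na nb by simp
  then have db: "d \<bullet> b \<le> k * R"
    unfolding d_def using k \<tau>(1) j(1)
    by (auto simp: inner_add_left intro!: add_decreasing2 mult_nonneg_nonpos mult_left_mono)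
  have kR: "k * R < k"
    using k c by simp
  have "(norm d)\<^sup>2 < e\<^sup>2"
    using dd k(3) kR by (simp add: power2_norm_eq_inner distrib_left)
  then have "norm d < e"
    using e by (simp add: power_less_imp_less_base)
  then have 1: "p + d \<in> ball p e"
    by (simp add: dist_norm)
  have "(norm (a - d))\<^sup>2 = 1 - 2 * (d \<bullet> a) + d \<bullet> d"
    using na by (simp add: power2_norm_eq_inner inner_diff_left inner_diff_right inner_commute
        norm_eq_1)
  then have "(norm (a - d))\<^sup>2 < 1\<^sup>2"
    using dd da kR by (simp add: distrib_left)
  then have "norm (a - d) < 1"
    by (rule power_less_imp_less_base) simp
  then have 2: "p + d \<in> ball u 1"
    by (simp add: dist_norm a_def algebra_simps)
  have "R\<^sup>2 < (norm (b - d))\<^sup>2"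
  proof -
    have "(norm (b - d))\<^sup>2 = R\<^sup>2 - 2 * (d \<bullet> b) + d \<bullet> d"
      unfolding nb(1)[symmetric]
      by (simp add: power2_norm_eq_inner inner_diff_left inner_diff_right inner_commute)
    then show ?thesis using dd db kR by (simp add: distrib_left)
  qed
  then have "R < norm (b - d)"
    by (rule power_less_imp_less_base) simp
  then have "p + d \<notin> cball c R"
    by (simp add: dist_norm b_def algebra_simps)
  with 1 2 show ?thesis by blast
qed

section \<open>Inscribed disks: uniform radius bound and second contact\<close>

text \<open>The distance to \<open>G\<close> attains its maximum on the compact closure of the
  inside. A maximum of at least 1 would yield an inscribed unit disk, so the maximum serves as
  \<open>\<rho>\<close> and leaves a margin \<open>1 - \<rho>\<close> common to all inscribed
  disks.\<close>

lemma inscribed_radius_bound: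
  fixes G :: "'a::euclidean_space set"
  assumes G: "compact G" "G \<noteq> {}" and no: "\<nexists>c. ball c 1 \<subseteq> inside G"
  obtains \<rho> where "\<rho> < 1" "\<And>c r. 0 < r \<Longrightarrow> ball c r \<subseteq> inside G \<Longrightarrow> r \<le> \<rho>"
proof (cases "inside G = {}")
  case True
  then show ?thesis by (intro that[of 0]) auto
next
  case False
  have cl: "closed G"
    using G by (simp add: compact_imp_closed)
  have "compact (closure (inside G))"
    using G by (simp add: bounded_inside compact_imp_bounded)
  then obtain p where p: "p \<in> closure (inside G)"
      "\<And>q. q \<in> closure (inside G) \<Longrightarrow> infdist q G \<le> infdist p G"
    using continuous_attains_sup[of "closure (inside G)" "\<lambda>q. infdist q G"] False
      continuous_on_infdist[OF continuous_on_id, of "closure (inside G)" G] by auto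
  show ?thesis
  proof (rule that[of "infdist p G"])
    show "infdist p G < 1"
    proof (rule ccontr)
      assume far: "\<not> infdist p G < 1"
      then have "p \<notin> G" by auto
      then have "p \<in> inside G"
        using p(1) closure_inside_subset[OF cl] by blast
      moreover have "ball p 1 \<inter> G = {}"
        using far infdist_le[of _ G p] by fastforce
      moreover have "p \<in> ball p 1" by simp
      ultimately have "ball p 1 \<subseteq> inside G"
        by (intro connected_subset_inside[OF cl connected_ball]) blast+
      with no show False by blast
    qed
    show "r \<le> infdist p G" if r: "0 < r" "ball c r \<subseteq> inside G" for c r
    proof -
      have "r \<le> infdist c G"
        using G ball_inside_imp_dist_ge[OF r(2)]
        by (simp add: infdist_notempty cINF_greatest)
      also have "\<dots> \<le> infdist p G"
        using r closure_subset by (intro p(2)) force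
      finally show ?thesis .
    qed
  qed
qed

text \<open>The disk tangent to the curve at z is inflated along the normal until it meets the
  rest of the curve.  By assumption this happens before it reaches radius 1, and until then the
  local unit disk keeps it away from the curve near z.\<close>

lemma inscribed_disk_two_contacts:
  fixes z u :: "'a::euclidean_space"
  assumes G: "compact G" and z: "z \<in> G" and u: "dist u z = 1" and e: "0 < e"
    and loc: "ball z e \<inter> ball u 1 \<subseteq> inside G" and no: "\<not> ball u 1 \<subseteq> inside G"
  obtains c r w where "0 < r" "ball c r \<subseteq> inside G" "dist c z = r" "w \<in> G" "w \<noteq> z" "dist c w = r"
proof -
  have cl: "closed G"
    using G by (simp add: compact_imp_closed)
  define \<nu> where "\<nu> = u - z"
  have n: "norm \<nu> = 1" and u_eq: "u = z + \<nu>"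
    using u by (auto simp: \<nu>_def dist_norm)
  have near: "ball (z + t *\<^sub>R \<nu>) t \<inter> inside G \<noteq> {}" "ball (z + t *\<^sub>R \<nu>) t \<subseteq> ball u 1"
    if t: "0 < t" "t \<le> 1" for t
  proof -
    have "dist u (z + t *\<^sub>R \<nu>) = norm ((1 - t) *\<^sub>R \<nu>)"
      by (simp add: u_eq dist_norm algebra_simps)
    then have "dist u (z + t *\<^sub>R \<nu>) = 1 - t"
      using t by (simp add: n)
    then show sub: "ball (z + t *\<^sub>R \<nu>) t \<subseteq> ball u 1"
      by (simp add: ball_subset_ball_iff dist_commute)
    \<comment> \<open>A point of the normal so close to \<open>z\<close> that it lies both in the
      disk of radius \<open>t\<close> and in \<open>ball z e\<close>; hence \<open>loc\<close> puts
      it inside.\<close>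
    define m where "m = min t e / 2"
    have m: "0 < m" "m < t" "m < e"
      using t e by (auto simp: m_def)
    have "dist (z + t *\<^sub>R \<nu>) (z + m *\<^sub>R \<nu>) = norm ((t - m) *\<^sub>R \<nu>)"
      by (simp add: dist_norm algebra_simps)
    then have "z + m *\<^sub>R \<nu> \<in> ball (z + t *\<^sub>R \<nu>) t"
      using m by (simp add: n)
    moreover have "z + m *\<^sub>R \<nu> \<in> ball z e"
      using m by (simp add: dist_norm n)
    ultimately show "ball (z + t *\<^sub>R \<nu>) t \<inter> inside G \<noteq> {}"
      using loc sub by blast
  qed
  \<comment> \<open>The part of \<open>G\<close> near \<open>z\<close> is dropped because
    \<open>loc\<close> already keeps the growing disks off it. What remains has positive distance
    from \<open>z\<close>, so the disk does not touch it at radius 0.\<close>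
  define K where "K = G - ball z e"
  have K: "compact K"
    unfolding K_def using G by (simp add: compact_diff)
  have u1: "ball u 1 \<inter> inside G \<noteq> {}"
    using near[of 1] by (auto simp: u_eq)
  then have "ball u 1 \<inter> G \<noteq> {}"
    using connected_subset_inside[OF cl connected_ball, of u 1] no by blast
  then obtain w1 where w1: "w1 \<in> ball u 1" "w1 \<in> K"
    using loc inside_no_overlap[of G] unfolding K_def by blast
  then have ne: "K \<noteq> {}" by auto
  \<comment> \<open>At a zero of \<open>h\<close> the disk of radius \<open>t\<close> touches
    \<open>K\<close> while its open disk misses \<open>K\<close>.\<close>
  define h where "h t = infdist (z + t *\<^sub>R \<nu>) K - t" for t
  have "continuous_on {0..1} h"
    unfolding h_def by (intro continuous_intros)
  moreover have "h 0 > 0"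
  proof -
    have "e \<le> infdist z K"
      using ne by (auto simp: infdist_notempty K_def intro!: cINF_greatest)
    then show ?thesis using e by (simp add: h_def)
  qed
  moreover have h1: "h 1 < 0"
    using infdist_le[OF w1(2), of u] w1(1) by (simp add: h_def u_eq)
  ultimately obtain t where t: "0 \<le> t" "t \<le> 1" "h t = 0"
    using IVT2'[of h 1 0 0] by (auto simp: less_imp_le)
  with \<open>h 0 > 0\<close> h1 have t01: "0 < t" "t < 1"
    by (auto simp: less_le)
  obtain w where w: "w \<in> K" "infdist (z + t *\<^sub>R \<nu>) K = dist (z + t *\<^sub>R \<nu>) w"
    using infdist_attains_inf[OF compact_imp_closed[OF K] ne] by blast
  have "ball (z + t *\<^sub>R \<nu>) t \<inter> K = {}"
    using infdist_le[of _ K "z + t *\<^sub>R \<nu>"] t by (force simp: h_def)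
  moreover have "ball (z + t *\<^sub>R \<nu>) t \<inter> (G \<inter> ball z e) = {}"
    using near(2)[OF t01(1)] t loc inside_no_overlap[of G] by blast
  ultimately have "ball (z + t *\<^sub>R \<nu>) t \<inter> G = {}"
    by (auto simp: K_def)
  then have "ball (z + t *\<^sub>R \<nu>) t \<subseteq> inside G"
    using near(1)[OF t01(1)] t by (intro connected_subset_inside[OF cl]) auto
  moreover have "dist (z + t *\<^sub>R \<nu>) z = t"
    using t by (simp add: dist_norm n)
  moreover have "dist (z + t *\<^sub>R \<nu>) w = t"
    using t w by (simp add: h_def)
  moreover have "w \<in> G" "w \<noteq> z"
    using w e by (auto simp: K_def)
  ultimately show ?thesis using that t01 by blast
qed

section \<open>Theta curves: how a chord cuts the inside\<close>

lemma chord_splits_inside: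
  fixes g :: "real \<Rightarrow> complex"
  assumes g: "simple_path g" "pathfinish g = pathstart g"
    and st: "0 \<le> s" "s < t" "t \<le> 1" "g s \<noteq> g t"
    and seg: "open_segment (g s) (g t) \<subseteq> inside (path_image g)"
  defines "A \<equiv> g ` {s..t}" and "C \<equiv> closed_segment (g s) (g t)"
  obtains B where "closed B" "A \<union> B = path_image g" "A \<inter> B = {g s, g t}"
    "inside (A \<union> C) \<inter> inside (B \<union> C) = {}"
    "inside (A \<union> C) \<union> inside (B \<union> C) \<union> (C - {g s, g t}) = inside (path_image g)"
proof -
  \<comment> \<open>Starting the loop at \<open>g s\<close> turns the complementary arc, which may
    pass through the old base point, into a single subpath.\<close>
  define h where "h = shiftpath s g"
  define l where "l = t - s"
  have sh: "simple_path h" "pathfinish h = pathstart h" "path_image h = path_image g"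
    using g st by (auto simp: h_def simple_path_shiftpath path_image_shiftpath
        pathfinish_shiftpath pathstart_shiftpath)
  have h0: "h 0 = g s" and hl: "h l = g t"
    using st by (auto simp: h_def l_def shiftpath_def)
  have h1: "h 1 = g s"
    using sh(2) h0 by (simp add: pathfinish_def pathstart_def)
  have l: "0 < l" "l < 1"
  proof -
    show "0 < l" using st by (simp add: l_def)
    have "l \<noteq> 1"
      using hl h1 st by auto
    then show "l < 1" using st by (auto simp: l_def)
  qed
  have A: "A = h ` {0..l}"
  proof -
    have "h ` {0..l} = (\<lambda>x. g (s + x)) ` {0..l}"
      using st by (intro image_cong) (auto simp: h_def l_def shiftpath_def)
    also have "\<dots> = g ` ((+) s ` {0..l})"
      by (simp only: image_image)
    also have "(+) s ` {0..l} = {s..t}"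
      by (simp add: l_def)
    finally show ?thesis by (simp add: A_def)
  qed
  \<comment> \<open>\<open>c2\<close> runs backwards from parameter 1, so that both arcs lead from
    \<open>g s\<close> to \<open>g t\<close>, as the theta-curve theorem requires.\<close>
  define c1 c2 where "c1 = subpath 0 l h" and "c2 = subpath 1 l h"
  have arcs: "arc c1" "arc c2"
    unfolding c1_def c2_def using sh l st h0 h1 hl by (auto intro!: arc_simple_path_subpath)
  have im1: "path_image c1 = A" and im2: "path_image c2 = h ` {l..1}"
    using l by (auto simp: c1_def c2_def path_image_subpath A)
  define B where "B = path_image c2"
  have un: "A \<union> B = path_image g"
  proof -
    have "{0..l} \<union> {l..1} = {0..1}" using l by auto
    then show ?thesis
      by (metis A B_def im2 image_Un path_image_def sh(3))
  qed
  have int: "A \<inter> B = {g s, g t}"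
  proof
    show "{g s, g t} \<subseteq> A \<inter> B"
    proof -
      have "h 0 \<in> A" "h l \<in> A" "h 1 \<in> B" "h l \<in> B"
        using l unfolding A B_def im2 by auto
      then show ?thesis by (simp add: h0 h1 hl)
    qed
    show "A \<inter> B \<subseteq> {g s, g t}"
    proof
      fix q assume "q \<in> A \<inter> B"
      then obtain x y where xy: "x \<in> {0..l}" "y \<in> {l..1}" "q = h x" "q = h y"
        by (auto simp: A B_def im2)
      then have "x = y \<or> x = 0 \<and> y = 1 \<or> x = 1 \<and> y = 0"
        using sh(1) l unfolding simple_path_def loop_free_def by (smt (verit) atLeastAtMost_iff)
      then show "q \<in> {g s, g t}"
        using xy l h0 h1 hl by auto
    qed
  qed
  have disj: "open_segment (g s) (g t) \<inter> path_image g = {}"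
    using seg inside_no_overlap[of "path_image g"] by blast
  have cut: "X \<inter> C = {g s, g t}" if "X \<subseteq> path_image g" "{g s, g t} \<subseteq> X" for X
    using that disj by (auto simp: C_def closed_segment_eq_open)
  have C: "C = path_image (linepath (g s) (g t))"
    by (simp add: C_def)
  have "midpoint (g s) (g t) \<in> open_segment (g s) (g t)"
    using st(4) by simp
  then have ne: "C \<inter> inside (A \<union> B) \<noteq> {}"
    using seg unfolding un C_def open_segment_def by blast
  have ends: "pathstart c1 = g s" "pathfinish c1 = g t" "pathstart c2 = g s" "pathfinish c2 = g t"
    using h0 h1 hl by (auto simp: c1_def c2_def)
  have AC: "A \<inter> C = {g s, g t}" and BC: "B \<inter> C = {g s, g t}"
    using un int by (auto intro!: cut)
  have "inside (A \<union> C) \<inter> inside (B \<union> C) = {} \<and>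
    inside (A \<union> C) \<union> inside (B \<union> C) \<union> (C - {g s, g t}) = inside (A \<union> B)"
    using split_inside_simple_closed_curve[of c1 "g s" "g t" c2 "linepath (g s) (g t)"]
      arcs[THEN arc_imp_simple_path] ends st(4) im1 int AC BC ne
    unfolding C B_def by auto
  moreover have "closed B"
    using arcs by (simp add: B_def closed_arc_image)
  ultimately show ?thesis
    using that[of B] un int by simp
qed

text \<open>\<open>z\<close> lies in the open outside of \<open>S\<close>, so near \<open>z\<close>
  neither \<open>S\<close> nor its inside is present. It is applied with \<open>S\<close> one arc
  plus the chord and \<open>X\<close> the pouch cut off by the other arc.\<close>

lemma inside_germ_at_arc:
  fixes z :: "'a::real_normed_vector"
  assumes "closed S" "z \<notin> S" "z \<notin> inside S" "J \<subseteq> X \<union> inside S \<union> S"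
  obtains e where "0 < e" "ball z e \<inter> J \<subseteq> X"
proof -
  have "z \<in> outside S"
    using assms(2,3) by (simp add: outside_inside)
  then obtain e where "0 < e" "ball z e \<subseteq> outside S"
    using open_outside[OF assms(1)] open_contains_ball by blast
  moreover have "outside S \<inter> (S \<union> inside S) = {}"
    unfolding outside_inside by blast
  ultimately show ?thesis
    using assms(4) by (intro that[of e]) blast+
qed

text \<open>A chord joining interior points of the two arcs would have to cross the first chord.\<close>

lemma chord_ends_on_same_arc:
  fixes g :: "real \<Rightarrow> complex"
  assumes g: "simple_path g" "pathfinish g = pathstart g"
    and st: "0 \<le> s" "s < t" "t \<le> 1" "g s \<noteq> g t"
    and seg: "open_segment (g s) (g t) \<subseteq> inside (path_image g)"
    and z: "z \<in> g ` {s..t}" "z \<noteq> g s" "z \<noteq> g t" and w: "w \<in> path_image g" "w \<noteq> z"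
    and seg': "open_segment z w \<subseteq> inside (path_image g)"
    and disj: "open_segment z w \<inter> closed_segment (g s) (g t) = {}"
  shows "w \<in> g ` {s..t}"
proof (rule ccontr)
  assume wA: "w \<notin> g ` {s..t}"
  define A C where "A = g ` {s..t}" and "C = closed_segment (g s) (g t)"
  define J where "J = inside (path_image g)"
  obtain B where B: "closed B" "A \<union> B = path_image g" "A \<inter> B = {g s, g t}"
    "inside (A \<union> C) \<inter> inside (B \<union> C) = {}"
    "inside (A \<union> C) \<union> inside (B \<union> C) \<union> (C - {g s, g t}) = J"
    using chord_splits_inside[OF g st seg] unfolding A_def C_def J_def by blast
  have "continuous_on {s..t} g"
    using g(1) st continuous_on_subset[of "{0..1}" g "{s..t}"]
    by (auto simp: simple_path_def path_def)
  then have clA: "closed A"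
    by (simp add: A_def compact_continuous_image compact_imp_closed)
  have clC: "closed C" by (simp add: C_def)
  have GJ: "path_image g \<inter> J = {}"
    using inside_no_overlap[of "path_image g"] unfolding J_def by blast
  have Cin: "C \<subseteq> J \<union> {g s, g t}"
    using seg by (auto simp: C_def J_def closed_segment_eq_open)
  have ends: "g s \<in> A" "g t \<in> A"
    using st by (auto simp: A_def)
  have zG: "z \<in> A" "z \<notin> J"
    using z(1) B(2) GJ by (auto simp: A_def)
  have wG: "w \<in> B" "w \<notin> J"
    using w(1) wA B(2) GJ by (auto simp: A_def)
  have "z \<notin> B \<union> C" "z \<notin> inside (B \<union> C)"
    using zG z B Cin by auto
  then obtain e1 where e1: "0 < e1" "ball z e1 \<inter> J \<subseteq> inside (A \<union> C)"
    using inside_germ_at_arc[of "B \<union> C" z J "inside (A \<union> C)"] B(1,5) clC by blast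
  have "w \<notin> A \<union> C" "w \<notin> inside (A \<union> C)"
    using wG wA B(5) Cin ends by (auto simp: A_def)
  then obtain e2 where e2: "0 < e2" "ball w e2 \<inter> J \<subseteq> inside (B \<union> C)"
    using inside_germ_at_arc[of "A \<union> C" w J "inside (B \<union> C)"] B(5) clA clC by blast
  \<comment> \<open>Near \<open>z\<close> the chord \<open>L\<close> lies in the pouch of
    \<open>A\<close>, near \<open>w\<close> in that of \<open>B\<close>. As it avoids
    \<open>C\<close>, these two disjoint open sets would disconnect it.\<close>
  define L where "L = open_segment z w"
  have cL: "z \<in> closure L" "w \<in> closure L"
    using w(2) by (auto simp: L_def closure_open_segment)
  have LJ: "L \<subseteq> J"
    using seg' by (simp add: L_def J_def)
  have "L \<inter> inside (A \<union> C) \<noteq> {}"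
    using cL(1) e1 LJ unfolding closure_approachable
    by (metis IntI dist_commute empty_iff mem_ball subsetD)
  moreover have "L \<inter> inside (B \<union> C) \<noteq> {}"
    using cL(2) e2 LJ unfolding closure_approachable
    by (metis IntI dist_commute empty_iff mem_ball subsetD)
  moreover have "connected L"
    by (simp add: L_def convex_connected)
  moreover have "open (inside (A \<union> C))" "open (inside (B \<union> C))"
    using clA clC B(1) by (auto intro: open_inside)
  moreover have "L \<subseteq> inside (A \<union> C) \<union> inside (B \<union> C)"
    using LJ disj B(5) by (auto simp: L_def C_def)
  ultimately show False
    using B(4) connectedD[of L "inside (A \<union> C)" "inside (B \<union> C)"] by blast
qed

section \<open>Contact arcs: halving, and a lower bound on their size\<close>

text \<open>Arcs are recorded by their parameter intervals, whose length the halving measures. For a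
  simple closed \<open>g\<close>, \<open>g s \<noteq> g t\<close> excludes just the full loop, whose
  chord would be degenerate.\<close>

definition contact_arc :: "(real \<Rightarrow> complex) \<Rightarrow> real \<Rightarrow> real \<Rightarrow> bool" where
  "contact_arc g s t \<longleftrightarrow> 0 \<le> s \<and> s < t \<and> t \<le> 1 \<and> g s \<noteq> g t \<and>
     (\<exists>c r. 0 < r \<and> ball c r \<subseteq> inside (path_image g) \<and> dist c (g s) = r \<and> dist c (g t) = r)"

lemma contact_arcI:
  assumes "a \<in> {0..1}" "b \<in> {0..1}" "g a \<noteq> g b" "0 < r" "ball c r \<subseteq> inside (path_image g)"
    "dist c (g a) = r" "dist c (g b) = r"
  shows "contact_arc g (min a b) (max a b)"
proof -
  have "a \<noteq> b" using assms(3) by blast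
  then show ?thesis
    using assms unfolding contact_arc_def
    by (intro conjI exI[of _ c] exI[of _ r]) (auto simp: min_def max_def)
qed

text \<open>A disk touching at the middle \<open>g m\<close> has its second contact on the same arc,
  because its chord cannot cross the given one. The two contacts therefore bound a subinterval of
  one half.\<close>

lemma contact_arc_halving:
  assumes g: "simple_path g" "pathfinish g = pathstart g"
    and two: "\<And>z. z \<in> path_image g \<Longrightarrow> \<exists>c r w. 0 < r \<and> ball c r \<subseteq> inside (path_image g) \<and>
        dist c z = r \<and> w \<in> path_image g \<and> w \<noteq> z \<and> dist c w = r"
    and arc: "contact_arc g s t"
  shows "\<exists>s' t'. contact_arc g s' t' \<and> t' - s' \<le> (t - s) / 2"
proof -
  obtain c r where st: "0 \<le> s" "s < t" "t \<le> 1" "g s \<noteq> g t"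
    and D: "0 < r" "ball c r \<subseteq> inside (path_image g)" "dist c (g s) = r" "dist c (g t) = r"
    using arc unfolding contact_arc_def by blast
  define m where "m = (s + t) / 2"
  have m: "s < m" "m < t" "m \<in> {0..1}" "m - s = (t - s) / 2" "t - m = (t - s) / 2"
    using st by (auto simp: m_def field_simps)
  have inj: "g a \<noteq> g m" if "a \<in> {0..1}" "a \<noteq> m" for a
    using g(1) that m st by (force simp: simple_path_def loop_free_def)
  have ends: "s \<in> {0..1}" "t \<in> {0..1}"
    using st by auto
  have zG: "g m \<in> path_image g"
    using m(3) by (simp add: path_image_def)
  have close: ?thesis if "k \<in> {s..t}" "contact_arc g (min m k) (max m k)" for k
  proof -
    have "max m k - min m k \<le> (t - s) / 2"
      using that(1) m by (auto simp: max_def min_def)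
    with that(2) show ?thesis by blast
  qed
  show ?thesis
  proof (cases "dist c (g m) = r")
    \<comment> \<open>Here the strict inequality needed for non-crossing chords fails, but
      \<open>g s\<close> and \<open>g m\<close> already share the given disk.\<close>
    case True
    show ?thesis
      using contact_arcI[OF m(3) ends(1) _ D(1,2) True D(3)] inj[OF ends(1)] m st
      by (intro close[of s]) auto
  next
    case False
    then have zr: "r < dist c (g m)"
      using ball_inside_imp_dist_ge[OF D(2) zG] by simp
    obtain c' r' w where E: "0 < r'" "ball c' r' \<subseteq> inside (path_image g)" "dist c' (g m) = r'"
        "w \<in> path_image g" "w \<noteq> g m" "dist c' w = r'"
      using two[OF zG] by blast
    have sG: "g s \<in> path_image g" "g t \<in> path_image g"
      using ends by (auto simp: path_image_def)
    have "w \<in> g ` {s..t}"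
    proof (rule chord_ends_on_same_arc[OF g st, of "g m"])
      show "open_segment (g s) (g t) \<subseteq> inside (path_image g)"
        using open_segment_subset_ball[of c "g s" r "g t"] D by auto
      show "open_segment (g m) w \<subseteq> inside (path_image g)"
        using open_segment_subset_ball[of c' "g m" r' w] E by auto
      show "open_segment (g m) w \<inter> closed_segment (g s) (g t) = {}"
        \<comment> \<open>Both disks are inscribed, so no contact of one lies in the other open
          disk; \<open>zr\<close> supplies the strict inequality.\<close>
        using D(3) ball_inside_imp_dist_ge[OF E(2) sG(1)] D(4)
          ball_inside_imp_dist_ge[OF E(2) sG(2)] E(3) zr E(6)
          ball_inside_imp_dist_ge[OF D(2) E(4)]
        by (rule chords_disjoint)
    qed (use m inj[OF ends(1)] inj[OF ends(2)] E in auto)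
    then obtain k where k: "k \<in> {s..t}" "w = g k" by blast
    show ?thesis
      using k E m(3) st by (intro close[of k] contact_arcI[of m k g r' c']) auto
  qed
qed

text \<open>The point of a short contact arc farthest from the center of its disk: there the pouch cut
  off by the chord lies in a disk of radius less than 1, which leaves no room for a unit disk.\<close>

lemma contact_arc_not_short:
  assumes g: "simple_path g" "pathfinish g = pathstart g"
    and bcc: "bounded_convex_curvature g"
    and st: "0 \<le> s" "s < t" "t \<le> 1" "g s \<noteq> g t"
    and D: "0 < r" "ball c r \<subseteq> inside (path_image g)" "dist c (g s) = r" "dist c (g t) = r"
    and short: "\<And>x. x \<in> {s..t} \<Longrightarrow> dist (g s) (g x) < 1 - r"
  shows False
proof -
  define A C where "A = g ` {s..t}" and "C = closed_segment (g s) (g t)"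
  define J where "J = inside (path_image g)"
  have seg: "open_segment (g s) (g t) \<subseteq> inside (path_image g)"
    using open_segment_subset_ball[of c "g s" r "g t"] D by auto
  obtain B where B: "closed B" "A \<union> B = path_image g" "A \<inter> B = {g s, g t}"
    "inside (A \<union> C) \<inter> inside (B \<union> C) = {}"
    "inside (A \<union> C) \<union> inside (B \<union> C) \<union> (C - {g s, g t}) = J"
    using chord_splits_inside[OF g st seg] unfolding A_def C_def J_def by blast
  have clC: "closed C" by (simp add: C_def)
  have "continuous_on {s..t} g"
    using g(1) st continuous_on_subset[of "{0..1}" g "{s..t}"]
    by (auto simp: simple_path_def path_def)
  then have "compact A"
    by (simp add: A_def compact_continuous_image)
  moreover have "A \<noteq> {}"
    using st by (auto simp: A_def)
  ultimately obtain p0 where p0: "p0 \<in> A" "\<And>q. q \<in> A \<Longrightarrow> dist c q \<le> dist c p0"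
    using continuous_attains_sup[of A "dist c"]
      continuous_on_dist[OF continuous_on_const continuous_on_id] by blast
  have ge: "r \<le> dist c q" if "q \<in> A" for q
    using ball_inside_imp_dist_ge[OF D(2)] that B(2) by blast
  have ends: "g s \<in> A" "g t \<in> A"
    using st by (auto simp: A_def)
  obtain p where p: "p \<in> A" "p \<noteq> g s" "p \<noteq> g t" "\<And>q. q \<in> A \<Longrightarrow> dist c q \<le> dist c p"
  proof (cases "p0 = g s \<or> p0 = g t")
    \<comment> \<open>The maximum is then \<open>r\<close>, which is also the minimum, so all of
      \<open>A\<close> lies on the circle and any interior point of the arc is a farthest
      one.\<close>
    case True
    then have "dist c p0 = r" using D by auto
    define m where "m = (s + t) / 2"
    have m: "s < m" "m < t" using st by (auto simp: m_def)
    have "g m \<in> A" using m by (auto simp: A_def)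
    moreover have "g m \<noteq> g s" "g m \<noteq> g t"
      using g(1) m st by (auto simp: simple_path_def loop_free_def) (smt (verit) atLeastAtMost_iff)+
    moreover have "dist c q \<le> dist c (g m)" if "q \<in> A" for q
      using p0(2)[OF that] ge[OF \<open>g m \<in> A\<close>] \<open>dist c p0 = r\<close> by simp
    ultimately show ?thesis using that by blast
  next
    case False
    then show ?thesis using that p0 by blast
  qed
  define R where "R = dist c p"
  have R1: "R < 1"
  proof -
    obtain x where "x \<in> {s..t}" "p = g x" using p(1) by (auto simp: A_def)
    then show ?thesis
      using short[of x] dist_triangle[of c p "g s"] D by (simp add: R_def)
  qed
  have GJ: "path_image g \<inter> J = {}"
    using inside_no_overlap[of "path_image g"] unfolding J_def by blast
  have Cin: "C \<subseteq> J \<union> {g s, g t}"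
    using seg by (auto simp: C_def J_def closed_segment_eq_open)
  have pG: "p \<in> path_image g" "p \<notin> J"
    using p(1) B(2) GJ by auto
  \<comment> \<open>\<open>p\<close> is interior to the arc \<open>A\<close>, so near
    \<open>p\<close> the inside of the curve consists only of the pouch of \<open>A\<close>.\<close>
  have "p \<notin> B \<union> C" "p \<notin> inside (B \<union> C)"
    using pG p B Cin by auto
  then obtain e1 where e1: "0 < e1" "ball p e1 \<inter> J \<subseteq> inside (A \<union> C)"
    using inside_germ_at_arc[of "B \<union> C" p J "inside (A \<union> C)"] B(1,5) clC by blast
  have "A \<subseteq> cball c R"
    using p(4) by (auto simp: R_def)
  moreover from this have "C \<subseteq> cball c R"
    using ends unfolding C_def by (intro closed_segment_subset) auto
  ultimately have pouch: "inside (A \<union> C) \<subseteq> cball c R"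
    by (intro inside_subset_cball) auto
  obtain u e where u: "p \<in> frontier (ball u 1)" "0 < e" "ball p e \<inter> ball u 1 \<subseteq> J"
    using bcc pG(1) unfolding bounded_convex_curvature_def J_def by blast
  have "dist u p = 1" using u(1) by simp
  moreover have "ball p (min e e1) \<inter> ball u 1 \<subseteq> cball c R"
    using u(3) e1(2) pouch by (auto simp: subset_iff)
  ultimately show False
    using unit_ball_germ_not_in_smaller_cball[of u p c R "min e e1"] R1 u(2) e1(1)
    by (simp add: R_def)
qed

section \<open>Repeated halving and the contradiction\<close>

theorem theorem1:
  fixes g :: "real \<Rightarrow> complex"
  assumes "jordan_curve g"
    and "bounded_convex_curvature g"
  shows "\<exists>c. ball c 1 \<subseteq> inside (path_image g)"
proof (rule ccontr)
  assume no: "\<nexists>c. ball c 1 \<subseteq> inside (path_image g)"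
  have g: "simple_path g" "pathfinish g = pathstart g"
    using assms(1) by (auto simp: jordan_curve_def)
  have cont: "continuous_on {0..1} g"
    using g(1) by (simp add: simple_path_def path_def)
  have comp: "compact (path_image g)" "path_image g \<noteq> {}"
    using g(1) by (auto simp: compact_simple_path_image)
  obtain \<rho> where \<rho>: "\<rho> < 1" "\<And>c r. 0 < r \<Longrightarrow> ball c r \<subseteq> inside (path_image g) \<Longrightarrow> r \<le> \<rho>"
    using inscribed_radius_bound[OF comp no] by blast
  have two: "\<exists>c r w. 0 < r \<and> ball c r \<subseteq> inside (path_image g) \<and>
        dist c z = r \<and> w \<in> path_image g \<and> w \<noteq> z \<and> dist c w = r"
    if z: "z \<in> path_image g" for z
  proof -
    obtain u e where "z \<in> frontier (ball u 1)" "0 < e" "ball z e \<inter> ball u 1 \<subseteq> inside (path_image g)"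
      using assms(2) z unfolding bounded_convex_curvature_def by blast
    then show ?thesis
      using inscribed_disk_two_contacts[OF comp(1) z, of u e] no by (metis frontier_ball
          mem_sphere zero_less_one)
  qed
  have "\<exists>s t. contact_arc g s t \<and> t - s \<le> (1 / 2) ^ n" for n
  proof (induction n)
    case 0
    \<comment> \<open>The first contact arc comes from a disk touching at the base point; its
      parameter length is at most 1.\<close>
    have "g 0 \<in> path_image g" by (simp add: path_image_def)
    then obtain c r w where w: "0 < r" "ball c r \<subseteq> inside (path_image g)" "dist c (g 0) = r"
        "w \<in> path_image g" "w \<noteq> g 0" "dist c w = r"
      using two by blast
    then obtain k where "k \<in> {0..1}" "w = g k"
      by (auto simp: path_image_def)
    then have "contact_arc g (min 0 k) (max 0 k)"
      using w by (intro contact_arcI[of 0 k g r c]) auto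
    then show ?case
      using \<open>k \<in> {0..1}\<close> by (intro exI[of _ "min 0 k"] exI[of _ "max 0 k"]) auto
  next
    case (Suc n)
    then obtain s t where "contact_arc g s t" "t - s \<le> (1 / 2) ^ n" by blast
    then show ?case
      using contact_arc_halving[OF g two, of s t] by fastforce
  qed
  moreover have "uniformly_continuous_on {0..1} g"
    using cont by (simp add: compact_uniformly_continuous)
  \<comment> \<open>A contact arc of parameter length below \<open>\<delta>\<close> stays within
    \<open>1 - \<rho>\<close> of \<open>g s\<close>, and \<open>1 - \<rho> \<le> 1 - r\<close>
    whatever the radius \<open>r\<close> of its disk.\<close>
  then obtain \<delta> where \<delta>: "0 < \<delta>" "\<And>x y. x \<in> {0..1} \<Longrightarrow> y \<in> {0..1} \<Longrightarrow> dist y x < \<delta> \<Longrightarrow>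
      dist (g y) (g x) < 1 - \<rho>"
    using \<rho>(1) unfolding uniformly_continuous_on_def by (metis diff_gt_0_iff_gt)
  moreover obtain n where "(1 / 2) ^ n < \<delta>"
    using real_arch_pow_inv[OF \<delta>(1), of "1 / 2"] by auto
  ultimately obtain s t where arc: "contact_arc g s t" "t - s < \<delta>"
    by (meson le_less_trans)
  then obtain c r where st: "0 \<le> s" "s < t" "t \<le> 1" "g s \<noteq> g t"
    and D: "0 < r" "ball c r \<subseteq> inside (path_image g)" "dist c (g s) = r" "dist c (g t) = r"
    unfolding contact_arc_def by blast
  show False
  proof (rule contact_arc_not_short[OF g assms(2) st D])
    fix x assume x: "x \<in> {s..t}"
    then have "dist (g s) (g x) < 1 - \<rho>"
      using arc(2) st by (intro \<delta>(2)) (auto simp: dist_real_def)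
    also have "\<dots> \<le> 1 - r"
      using \<rho>(2)[OF D(1,2)] by simp
    finally show "dist (g s) (g x) < 1 - r" .
  qed
qed

end
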